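(* Let $K\in\mathcal{K}^n$ and let $\lambda_i=\lambda_i(K)$, $i=1,\dots,n$, be its successive minima. Then $$\mathrm{G}(K)\leq\prod_{i=1}^n\left(\frac{2}{\lambda_i}+n\right).$$
   Context: $\mathcal{K}^n$ is the class of all compact convex sets in $\mathbb{R}^n$ with non-empty interior. For $A\subseteq\mathbb{R}^n$, $\mathrm{G}(A)=|A\cap\mathbb{Z}^n|$ is the number of integer points in $A$. For $K\in\mathcal{K}^n$ with $K=-K$, the $i$-th successive minimum is $\lambda_i(K)=\min\{\lambda>0:\dim(\lambda K\cap\mathbb{Z}^n)\geq i\}$, $1\le i\le n$, where $\dim$ of a set of lattice points in the symmetric body is the dimension of its linear span. For general $K\in\mathcal{K}^n$ one puts $\lambda_i(K)=\lambda_i(\mathrm{cs}(K))$, where $\mathrm{cs}(K)=\frac12(K-K)$. *)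

theory Defs
  imports "HOL-Analysis.Analysis"
begin

definition convex_body :: "(real ^ 'n) set \<Rightarrow> bool" where
  "convex_body K \<longleftrightarrow> compact K \<and> convex K \<and> interior K \<noteq> {}"

definition int_lattice :: "(real ^ 'n) set" where
  "int_lattice = {x. \<forall>i. x $ i \<in> \<int>}"

text \<open>Only used for bounded sets, where the intersection is finite and
  \<^const>\<open>card\<close> is the true number of points.\<close>

definition lattice_count :: "(real ^ 'n) set \<Rightarrow> nat" where
  "lattice_count A = card (A \<inter> int_lattice)"

definition central_sym :: "(real ^ 'n) set \<Rightarrow> (real ^ 'n) set" where
  "central_sym K = {(1 / 2) *\<^sub>R (x - y) | x y. x \<in> K \<and> y \<in> K}"

text \<open>The successive minima of an origin-symmetric convex body. Here \<^const>\<open>dim\<close> is the dimension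
  of the linear span, and the index \<open>i\<close> runs from 1 to \<open>n\<close>. In that range the minimum
  exists, so that \<^const>\<open>Least\<close> picks it out; for \<open>i = 0\<close> or \<open>i > n\<close> it does not.\<close>

definition succ_min_sym :: "nat \<Rightarrow> (real ^ 'n) set \<Rightarrow> real" where
  "succ_min_sym i C = (LEAST t. 0 < t \<and> i \<le> dim (((*\<^sub>R) t ` C) \<inter> int_lattice))"

definition succ_min :: "nat \<Rightarrow> (real ^ 'n) set \<Rightarrow> real" where
  "succ_min i K = succ_min_sym i (central_sym K)"

end

theory Submission
  imports Defs
begin

text \<open>Let \<open>v\<^sub>i\<close> be linearly independent lattice points with \<open>v\<^sub>i \<in> \<lambda>\<^sub>i cs(K)\<close>, let \<open>L\<^sub>i\<close> be the span of
  the first \<open>i\<close> of them, and put \<open>t\<^sub>i = 1 / (2 / \<lambda>\<^sub>i + n)\<close>. As in the classical proof of Minkowski's second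
  theorem, bodies are dilated step by step along the flag of the \<open>L\<^sub>i\<close>, but volumes of their images
  in the torus are replaced by numbers of lattice points that are incongruent modulo a large \<open>N\<close>.
  By induction on \<open>i\<close>, a finite set \<open>X\<close> of lattice points of \<open>K\<close> in one coset of \<open>L\<^sub>i\<close> yields
  \<open>|X| \<Prod>\<^sub>j\<^sub>\<le>\<^sub>i \<lfloor>N t\<^sub>j\<rfloor>\<close> incongruent lattice points of \<open>L\<^sub>i\<close> in a translate of \<open>T (conv X + P\<^sub>i)\<close>, for
  \<open>T \<ge> N t\<^sub>i\<close> and \<open>P\<^sub>i = \<Sum>\<^sub>j\<^sub>\<le>\<^sub>i [0,1) v\<^sub>j\<close>. In the step, \<open>X\<close> is cut into its layers parallel to
  \<open>L\<^sub>i\<^sub>-\<^sub>1\<close>, and each layer, thickened by \<open>[0,1) c v\<^sub>i\<close> with suitable \<open>0 < c \<le> 1\<close>, meets \<open>\<lfloor>N t\<^sub>i\<rfloor>\<close> lattice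
  layers after dilation by \<open>N t\<^sub>i\<close>. Points from different layers are incongruent: otherwise their
  difference divided by \<open>N\<close> would be a lattice point of \<open>r cs(K)\<close> outside \<open>L\<^sub>i\<^sub>-\<^sub>1\<close>, where
  \<open>r < t\<^sub>i (2 + n \<lambda>\<^sub>i) = \<lambda>\<^sub>i\<close>. For \<open>i = n\<close> there are at most \<open>N\<^sup>n\<close> incongruent points; let \<open>N\<close> tend to
  infinity.\<close>

section \<open>The integer lattice\<close>

lemma int_lattice_0 [simp]: "0 \<in> int_lattice"
  by (simp add: int_lattice_def)

lemma int_lattice_add: "x \<in> int_lattice \<Longrightarrow> y \<in> int_lattice \<Longrightarrow> x + y \<in> int_lattice"
  by (simp add: int_lattice_def)

lemma int_lattice_diff: "x \<in> int_lattice \<Longrightarrow> y \<in> int_lattice \<Longrightarrow> x - y \<in> int_lattice"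
  by (simp add: int_lattice_def)

lemma int_lattice_scaleR: "x \<in> int_lattice \<Longrightarrow> a \<in> \<int> \<Longrightarrow> a *\<^sub>R x \<in> int_lattice"
  by (simp add: int_lattice_def)

lemma Basis_subset_int_lattice: "Basis \<subseteq> (int_lattice :: (real ^ 'n) set)"
  by (auto simp: Basis_vec_def int_lattice_def axis_def)

lemma finite_bounded_int_lattice:
  fixes S :: "(real ^ 'n) set"
  assumes "bounded S"
  shows "finite (S \<inter> int_lattice)"
proof -
  obtain B where B: "\<And>x. x \<in> S \<Longrightarrow> norm x \<le> B"
    using assms by (auto simp: bounded_iff)
  let ?g = "\<lambda>(x :: real ^ 'n) i. \<lfloor>x $ i\<rfloor>"
  have "?g ` (S \<inter> int_lattice) \<subseteq> Pi\<^sub>E UNIV (\<lambda>_. {- \<lceil>B\<rceil> .. \<lceil>B\<rceil>})"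
  proof (rule image_subsetI)
    fix x :: "real ^ 'n" assume x: "x \<in> S \<inter> int_lattice"
    have "- \<lceil>B\<rceil> \<le> \<lfloor>x $ i\<rfloor> \<and> \<lfloor>x $ i\<rfloor> \<le> \<lceil>B\<rceil>" for i
    proof -
      have "\<bar>x $ i\<bar> \<le> B"
        using B[of x] x component_le_norm_cart[of x i] by auto
      then show ?thesis by linarith
    qed
    then show "?g x \<in> Pi\<^sub>E UNIV (\<lambda>_. {- \<lceil>B\<rceil> .. \<lceil>B\<rceil>})" by auto
  qed
  then have "finite (?g ` (S \<inter> int_lattice))"
    by (rule finite_subset) (simp add: finite_PiE)
  moreover have "inj_on ?g (S \<inter> int_lattice)"
  proof (rule inj_onI)
    fix x y assume "x \<in> S \<inter> int_lattice" "y \<in> S \<inter> int_lattice" and eq: "?g x = ?g y"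
    then have "x $ i = of_int \<lfloor>x $ i\<rfloor>" "y $ i = of_int \<lfloor>y $ i\<rfloor>" for i
      by (auto simp: int_lattice_def)
    with fun_cong[OF eq] show "x = y"
      by (metis vec_eq_iff)
  qed
  ultimately show ?thesis
    by (simp add: finite_image_iff)
qed

text \<open>Reducing every coordinate modulo \<open>N\<close> is injective on \<open>Y\<close>, and
  there are only \<open>N ^ CARD('n)\<close> residue vectors.\<close>

lemma card_incongruent_le:
  fixes Y :: "(real ^ 'n) set" and N :: nat
  assumes "N > 0" and "Y \<subseteq> int_lattice"
    and incongruent: "\<And>y y' z. y \<in> Y \<Longrightarrow> y' \<in> Y \<Longrightarrow> z \<in> int_lattice
      \<Longrightarrow> y - y' = real N *\<^sub>R z \<Longrightarrow> y = y'"
  shows "card Y \<le> N ^ CARD('n)"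
proof -
  let ?g = "\<lambda>(x :: real ^ 'n) i. \<lfloor>x $ i\<rfloor> mod int N"
  let ?R = "Pi\<^sub>E (UNIV :: 'n set) (\<lambda>_. {0..<int N})"
  have "inj_on ?g Y"
  proof (rule inj_onI)
    fix y y' assume y: "y \<in> Y" "y' \<in> Y" and eq: "?g y = ?g y'"
    define z :: "real ^ 'n" where "z = (\<chi> i. of_int ((\<lfloor>y $ i\<rfloor> - \<lfloor>y' $ i\<rfloor>) div int N))"
    have "z \<in> int_lattice"
      by (simp add: z_def int_lattice_def)
    moreover have "y - y' = real N *\<^sub>R z"
    proof (rule vec_eq_iff[THEN iffD2], rule allI)
      fix i
      have "y $ i = of_int \<lfloor>y $ i\<rfloor>" "y' $ i = of_int \<lfloor>y' $ i\<rfloor>"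
        using y assms(2) by (auto simp: int_lattice_def)
      moreover have "int N dvd \<lfloor>y $ i\<rfloor> - \<lfloor>y' $ i\<rfloor>"
        using fun_cong[OF eq, of i] by (simp add: mod_eq_dvd_iff)
      then have "real_of_int (\<lfloor>y $ i\<rfloor> - \<lfloor>y' $ i\<rfloor>)
          = of_int (int N * ((\<lfloor>y $ i\<rfloor> - \<lfloor>y' $ i\<rfloor>) div int N))"
        by simp
      ultimately show "(y - y') $ i = (real N *\<^sub>R z) $ i"
        by (simp add: z_def del: floor_of_int)
    qed
    ultimately show "y = y'"
      using incongruent y by blast
  qed
  moreover have "?g ` Y \<subseteq> ?R"
    using assms(1) by auto
  moreover have "finite ?R"
    by (intro finite_PiE) auto
  ultimately have "card Y \<le> card ?R"
    by (metis card_inj_on_le)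
  also have "\<dots> = N ^ CARD('n)"
    by (simp add: card_PiE)
  finally show ?thesis .
qed

section \<open>Dilates of a convex set\<close>

text \<open>With \<open>x = r a\<close> and \<open>y = s b\<close>, the sum is \<open>r + s\<close>
  times the convex combination of \<open>a\<close> and \<open>b\<close> with weights
  \<open>r / (r + s)\<close> and \<open>s / (r + s)\<close>; if \<open>r + s = 0\<close>, both
  summands vanish.\<close>

lemma convex_dilate_add:
  fixes C :: "'a :: real_vector set"
  assumes "convex C" "0 \<le> r" "0 \<le> s" "x \<in> (*\<^sub>R) r ` C" "y \<in> (*\<^sub>R) s ` C"
  shows "x + y \<in> (*\<^sub>R) (r + s) ` C"
proof (cases "r + s = 0")
  case True
  then show ?thesis
    using assms by (auto simp: add_nonneg_eq_0_iff)
next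
  case False
  obtain a b where ab: "a \<in> C" "b \<in> C" "x = r *\<^sub>R a" "y = s *\<^sub>R b"
    using assms by blast
  have "(r / (r + s)) *\<^sub>R a + (s / (r + s)) *\<^sub>R b \<in> C"
    using assms False ab by (intro convexD) (auto simp: add_divide_distrib[symmetric])
  moreover have "x + y = (r + s) *\<^sub>R ((r / (r + s)) *\<^sub>R a + (s / (r + s)) *\<^sub>R b)"
    using False by (simp add: ab scaleR_add_right)
  ultimately show ?thesis by blast
qed

lemma convex_dilate_mono:
  fixes C :: "'a :: real_vector set"
  assumes "convex C" "0 \<in> C" "0 \<le> r" "r \<le> s"
  shows "(*\<^sub>R) r ` C \<subseteq> (*\<^sub>R) s ` C"
proof
  fix x assume "x \<in> (*\<^sub>R) r ` C"
  moreover have "0 \<in> (*\<^sub>R) (s - r) ` C"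
    using assms(2) by force
  ultimately show "x \<in> (*\<^sub>R) s ` C"
    using convex_dilate_add[of C r "s - r" x 0] assms by simp
qed

lemma convex_dilate_sum:
  fixes C :: "'a :: real_vector set"
  assumes "convex C" "0 \<in> C" "finite J"
    and "\<And>j. j \<in> J \<Longrightarrow> 0 \<le> r j" "\<And>j. j \<in> J \<Longrightarrow> x j \<in> (*\<^sub>R) (r j) ` C"
  shows "sum x J \<in> (*\<^sub>R) (sum r J) ` C"
  using assms(3-)
proof (induction J)
  case empty
  then show ?case using assms(2) by force
next
  case (insert j J)
  then show ?case
    using convex_dilate_add[OF assms(1), of "r j" "sum r J" "x j" "sum x J"]
    by (simp add: sum_nonneg)
qed

lemma symmetric_dilate_scaleR:
  fixes C :: "'a :: real_vector set"
  assumes "\<And>x. x \<in> C \<Longrightarrow> - x \<in> C" and "x \<in> (*\<^sub>R) r ` C"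
  shows "a *\<^sub>R x \<in> (*\<^sub>R) (\<bar>a\<bar> * r) ` C"
proof -
  obtain c where c: "c \<in> C" "x = r *\<^sub>R c"
    using assms(2) by blast
  show ?thesis
  proof (cases "a \<ge> 0")
    case True
    then show ?thesis using c by auto
  next
    case False
    then have "a *\<^sub>R x = (\<bar>a\<bar> * r) *\<^sub>R (- c)"
      using c by simp
    then show ?thesis using assms(1)[OF c(1)] by blast
  qed
qed

lemma mem_dilate_iff:
  fixes C :: "'a :: real_vector set"
  assumes "r > 0"
  shows "x \<in> (*\<^sub>R) r ` C \<longleftrightarrow> (1 / r) *\<^sub>R x \<in> C"
proof
  assume "(1 / r) *\<^sub>R x \<in> C"
  moreover have "x = r *\<^sub>R ((1 / r) *\<^sub>R x)" using assms by simp
  ultimately show "x \<in> (*\<^sub>R) r ` C" by blast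
qed (use assms in auto)

text \<open>The number \<open>m\<close> is the gauge of \<open>x\<close> with respect to
  \<open>C\<close>. The multipliers \<open>u\<close> with \<open>u x\<close> in \<open>C\<close>
  form a compact set whose maximum is positive because 0 is interior to \<open>C\<close>;
  \<open>m\<close> is the reciprocal of that maximum.\<close>

lemma compact_convex_min_dilate:
  fixes C :: "'a :: euclidean_space set"
  assumes "compact C" "convex C" "0 \<in> interior C" "x \<noteq> 0"
  shows "\<exists>m>0. \<forall>s>0. x \<in> (*\<^sub>R) s ` C \<longleftrightarrow> m \<le> s"
proof -
  have C0: "0 \<in> C" using assms(3) interior_subset by blast
  define U where "U = {u. u *\<^sub>R x \<in> C}"
  have "closed U"
  proof -
    have "U = (\<lambda>u. u *\<^sub>R x) -` C" by (auto simp: U_def)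
    moreover have "closed ((\<lambda>u. u *\<^sub>R x) -` C)"
      by (intro closed_vimage compact_imp_closed assms continuous_intros)
    ultimately show ?thesis by simp
  qed
  moreover obtain B where B: "\<And>y. y \<in> C \<Longrightarrow> norm y \<le> B"
    using compact_imp_bounded[OF assms(1)] by (auto simp: bounded_iff)
  have "bounded U"
    unfolding bounded_iff
  proof (intro exI ballI)
    fix u assume "u \<in> U"
    then have "\<bar>u\<bar> * norm x \<le> B" using B by (force simp: U_def)
    then show "norm u \<le> B / norm x" using assms(4) by (simp add: field_simps)
  qed
  ultimately have "compact U" by (simp add: compact_eq_bounded_closed)
  moreover have "0 \<in> U" using C0 by (simp add: U_def)
  ultimately obtain u where u: "u \<in> U" "\<And>w. w \<in> U \<Longrightarrow> w \<le> u"
    using compact_attains_sup[of U] by blast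
  obtain e where e: "e > 0" "ball 0 e \<subseteq> C"
    using assms(3) by (auto simp: mem_interior)
  have "(e / 2 / norm x) *\<^sub>R x \<in> ball 0 e" using e assms(4) by simp
  then have "e / 2 / norm x \<in> U" using e(2) by (auto simp: U_def)
  moreover have "0 < e / 2 / norm x" using e assms(4) by simp
  ultimately have upos: "0 < u" using u(2) by fastforce
  have "x \<in> (*\<^sub>R) s ` C \<longleftrightarrow> 1 / u \<le> s" if s: "s > 0" for s
  proof -
    have "x \<in> (*\<^sub>R) s ` C \<longleftrightarrow> 1 / s \<in> U"
      by (simp add: mem_dilate_iff[OF s] U_def)
    also have "\<dots> \<longleftrightarrow> 1 / s \<le> u"
    proof
      assume le: "1 / s \<le> u"
      have "(1 / (s * u)) *\<^sub>R (u *\<^sub>R x) + (1 - 1 / (s * u)) *\<^sub>R 0 \<in> C"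
        using u(1) C0 s upos le
        by (intro convexD[OF assms(2)]) (auto simp: U_def field_simps)
      then show "1 / s \<in> U" using upos s by (simp add: U_def)
    qed (rule u(2))
    also have "\<dots> \<longleftrightarrow> 1 / u \<le> s" using s upos by (simp add: field_simps)
    finally show ?thesis .
  qed
  then show ?thesis using upos by (intro exI[of _ "1 / u"]) simp
qed

section \<open>Successive minima\<close>

text \<open>\<open>Least\<close> on the reals is meaningful only once a minimum is attained. Among
  the admissible \<open>t\<close>, one with the fewest lattice points in \<open>t C\<close> is
  taken. These points occur in every admissible dilate, so the largest gauge \<open>\<mu>\<close> of
  a nonzero one among them is the minimum.\<close>

lemma succ_min_sym_least:
  fixes C :: "(real ^ 'n) set"
  assumes "compact C" "convex C" "0 \<in> interior C" and "1 \<le> i" "i \<le> CARD('n)"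
  shows "0 < succ_min_sym i C"
    and "i \<le> dim ((*\<^sub>R) (succ_min_sym i C) ` C \<inter> int_lattice)"
    and "\<And>t. 0 < t \<Longrightarrow> i \<le> dim ((*\<^sub>R) t ` C \<inter> int_lattice) \<Longrightarrow> succ_min_sym i C \<le> t"
proof -
  have C0: "0 \<in> C" using assms(3) interior_subset by blast
  define D where "D t = (*\<^sub>R) t ` C \<inter> int_lattice" for t :: real
  define S where "S = {t. 0 < t \<and> i \<le> dim (D t)}"
  have D_mono: "D s \<subseteq> D t" if "0 < s" "s \<le> t" for s t
    using convex_dilate_mono[OF assms(2) C0, of s t] that by (auto simp: D_def)
  have D_fin: "finite (D t)" for t
    unfolding D_def
    by (intro finite_bounded_int_lattice compact_imp_bounded compact_scaling assms)
  have "\<exists>t. t \<in> S"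
  proof -
    obtain e where e: "e > 0" "ball 0 e \<subseteq> C"
      using assms(3) by (auto simp: mem_interior)
    \<comment> \<open>Since \<open>(e / 2) b\<close> lies in the ball, this dilate contains the
      standard basis, so admissible factors exist.\<close>
    have "b \<in> D (2 / e)" if "b \<in> Basis" for b
    proof -
      have "(1 / (2 / e)) *\<^sub>R b \<in> C" using e that by (intro subsetD[OF e(2)]) simp
      then show ?thesis
        using that Basis_subset_int_lattice mem_dilate_iff[of "2 / e" b C] e(1)
        by (auto simp: D_def)
    qed
    then have "dim (Basis :: (real ^ 'n) set) \<le> dim (D (2 / e))"
      by (intro dim_subset) auto
    then show ?thesis
      using assms(5) e(1) by (intro exI[of _ "2 / e"]) (simp add: S_def dim_eq_card_independent independent_Basis)
  qed
  then obtain t where t: "t \<in> S" "\<And>s. s \<in> S \<Longrightarrow> card (D t) \<le> card (D s)"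
    using ex_has_least_nat[of "\<lambda>t. t \<in> S" _ "\<lambda>t. card (D t)"] by blast
  obtain m where m: "\<And>x. x \<noteq> 0 \<Longrightarrow> m x > 0"
    "\<And>x s. x \<noteq> 0 \<Longrightarrow> s > 0 \<Longrightarrow> x \<in> (*\<^sub>R) s ` C \<longleftrightarrow> m x \<le> s"
    using compact_convex_min_dilate[OF assms(1-3)] by metis
  define F where "F = D t - {0}"
  have "F \<noteq> {}"
  proof
    assume "F = {}"
    then have "D t \<subseteq> {0}" by (auto simp: F_def)
    then have "dim (D t) = 0" by (simp add: dim_eq_0)
    then show False using t(1) assms(4) by (simp add: S_def del: dim_eq_0)
  qed
  have F_fin: "finite F" using D_fin by (simp add: F_def)
  define \<mu> where "\<mu> = Max (m ` F)"
  have m_le: "m x \<le> \<mu>" if "x \<in> F" for x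
    using that F_fin by (simp add: \<mu>_def)
  have \<mu>_mem: "\<mu> \<in> m ` F"
    unfolding \<mu>_def using F_fin \<open>F \<noteq> {}\<close> by (intro Max_in) auto
  then have \<mu>_pos: "0 < \<mu>" using m(1) by (auto simp: F_def)
  have "D t \<subseteq> D \<mu>"
  proof
    fix x assume x: "x \<in> D t"
    show "x \<in> D \<mu>"
    proof (cases "x = 0")
      case True
      then show ?thesis using C0 by (force simp: D_def)
    next
      case False
      then show ?thesis
        using x m_le[of x] m(2)[OF False \<mu>_pos] by (auto simp: D_def F_def)
    qed
  qed
  then have "\<mu> \<in> S"
    using t(1) \<mu>_pos dim_subset[of "D t" "D \<mu>"] by (auto simp: S_def)
  moreover have least: "\<mu> \<le> s" if s: "s \<in> S" for s
  proof -
    \<comment> \<open>If \<open>s < t\<close>, then \<open>D s\<close> is a subset of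
      \<open>D t\<close> with at least as many points, hence equal to it.\<close>
    have "D t \<subseteq> D s"
    proof (cases "t \<le> s")
      case True
      then show ?thesis using t(1) D_mono by (auto simp: S_def)
    next
      case False
      then have "D s \<subseteq> D t" using s D_mono by (auto simp: S_def)
      then show ?thesis using t(2)[OF s] D_fin card_seteq by blast
    qed
    moreover obtain x where "x \<in> F" "\<mu> = m x" using \<mu>_mem by blast
    ultimately show ?thesis using m(2)[of x s] s by (auto simp: F_def D_def S_def)
  qed
  ultimately have eq: "succ_min_sym i C = \<mu>"
    unfolding succ_min_sym_def by (intro Least_equality) (auto simp: S_def D_def)
  show "0 < succ_min_sym i C" "i \<le> dim ((*\<^sub>R) (succ_min_sym i C) ` C \<inter> int_lattice)"
    using \<open>\<mu> \<in> S\<close> by (auto simp: eq S_def D_def)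
  show "succ_min_sym i C \<le> t" if "0 < t" "i \<le> dim ((*\<^sub>R) t ` C \<inter> int_lattice)" for t
    using least[of t] that by (auto simp: eq S_def D_def)
qed

text \<open>Greedy choice: the lattice points of the next dilate span dimension at least
  \<open>Suc k\<close>, so one of them lies outside the span of the \<open>k\<close> vectors chosen
  so far.\<close>

lemma succ_min_sym_vectors:
  fixes C :: "(real ^ 'n) set"
  assumes "compact C" "convex C" "0 \<in> interior C" and "k \<le> CARD('n)"
  shows "\<exists>v. \<forall>i\<in>{1..k}. v i \<in> (*\<^sub>R) (succ_min_sym i C) ` C \<inter> int_lattice
    \<and> v i \<notin> span (v ` {1..<i})"
  using assms(4)
proof (induction k)
  case 0
  then show ?case by simp
next
  case (Suc k)
  then obtain v where v: "\<forall>i\<in>{1..k}. v i \<in> (*\<^sub>R) (succ_min_sym i C) ` C \<inter> int_lattice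
    \<and> v i \<notin> span (v ` {1..<i})" by auto
  let ?D = "(*\<^sub>R) (succ_min_sym (Suc k) C) ` C \<inter> int_lattice"
  have "dim (v ` {1..k}) \<le> k"
    using dim_le_card'[of "v ` {1..k}"] card_image_le[of "{1..k}" v] by simp
  moreover have "Suc k \<le> dim ?D"
    using succ_min_sym_least(2)[OF assms(1-3)] Suc.prems by simp
  ultimately have "\<not> ?D \<subseteq> span (v ` {1..k})"
    using dim_subset[of ?D "span (v ` {1..k})"] by auto
  then obtain x where x: "x \<in> ?D" "x \<notin> span (v ` {1..k})" by blast
  have im: "(v(Suc k := x)) ` {1..<i} = v ` {1..<i}" if "i \<le> Suc k" for i
    using that by (intro image_cong) auto
  show ?case
  proof (intro exI[of _ "v(Suc k := x)"] ballI)
    fix i assume i: "i \<in> {1..Suc k}"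
    show "(v(Suc k := x)) i \<in> (*\<^sub>R) (succ_min_sym i C) ` C \<inter> int_lattice
      \<and> (v(Suc k := x)) i \<notin> span ((v(Suc k := x)) ` {1..<i})"
      using i v x im[of i] by (cases "i = Suc k") (auto simp: atLeastLessThanSuc_atLeastAtMost)
  qed
qed

lemma independent_greedy:
  fixes v :: "nat \<Rightarrow> 'a :: real_vector"
  assumes "\<And>i. i \<in> {1..k} \<Longrightarrow> v i \<notin> span (v ` {1..<i})"
  shows "independent (v ` {1..k}) \<and> card (v ` {1..k}) = k"
  using assms
proof (induction k)
  case 0
  then show ?case by (simp add: independent_empty)
next
  case (Suc k)
  have "v (Suc k) \<notin> span (v ` {1..k})"
    using Suc.prems[of "Suc k"] by (simp add: atLeastLessThanSuc_atLeastAtMost)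
  moreover have "v (Suc k) \<notin> v ` {1..k}"
    using calculation span_base[of "v (Suc k)" "v ` {1..k}"] by argo
  ultimately show ?case
    using Suc by (simp add: atLeastAtMostSuc_conv independent_insertI)
qed

section \<open>The symmetric body \<open>cs(K)\<close>\<close>

lemma central_sym_eq_image:
  "central_sym K = (\<lambda>z. (1 / 2) *\<^sub>R (fst z - snd z)) ` (K \<times> K)"
  by (force simp: central_sym_def)

lemma compact_central_sym: "compact K \<Longrightarrow> compact (central_sym K)"
  unfolding central_sym_eq_image
  by (intro compact_continuous_image compact_Times continuous_intros)

lemma convex_central_sym:
  assumes "convex K"
  shows "convex (central_sym K)"
proof -
  have "central_sym K = (*\<^sub>R) (1 / 2) ` (\<Union>x\<in>K. \<Union>y\<in>K. {x - y})"
    by (auto simp: central_sym_def)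
  then show ?thesis
    by (simp only: convex_scaling convex_differences assms)
qed

lemma central_sym_uminus: "x \<in> central_sym K \<Longrightarrow> - x \<in> central_sym K"
  by (force simp: central_sym_def algebra_simps)

text \<open>The factor 2 here is the origin of the numerator 2 in the bound.\<close>

lemma diff_mem_dilate_central_sym:
  "x \<in> K \<Longrightarrow> y \<in> K \<Longrightarrow> x - y \<in> (*\<^sub>R) 2 ` central_sym K"
  by (force simp: central_sym_def image_iff)

lemma zero_in_interior_central_sym:
  assumes "interior K \<noteq> {}"
  shows "0 \<in> interior (central_sym K)"
proof -
  obtain a e where e: "e > 0" "ball a e \<subseteq> K"
    using assms by (auto simp: mem_interior)
  have "ball 0 (e / 2) \<subseteq> central_sym K"
  proof
    fix z :: "real ^ 'a" assume "z \<in> ball 0 (e / 2)"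
    then have "a + 2 *\<^sub>R z \<in> K" "a \<in> K"
      using e by (auto simp: dist_norm intro!: subsetD[OF e(2)])
    moreover have "z = (1 / 2) *\<^sub>R ((a + 2 *\<^sub>R z) - a)" by simp
    ultimately show "z \<in> central_sym K"
      unfolding central_sym_def by blast
  qed
  then show ?thesis
    using e(1) by (auto simp: mem_interior intro!: exI[of _ "e / 2"])
qed

section \<open>Incongruent lattice points along the flag of the successive minima\<close>

text \<open>Collects what the induction uses about the minima. Minimality of \<open>lam\<close>
  enters only through \<open>lam_mono\<close> and \<open>short\<close>; the latter makes points from
  different layers incongruent.\<close>

locale minima_vectors =
  fixes K :: "(real ^ 'n) set" and lam :: "nat \<Rightarrow> real" and v :: "nat \<Rightarrow> real ^ 'n"
  assumes convex_K: "convex K" and K_nonempty: "K \<noteq> {}"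
    and lam_pos: "\<And>i. i \<in> {1..CARD('n)} \<Longrightarrow> 0 < lam i"
    and lam_mono: "\<And>i j. 1 \<le> i \<Longrightarrow> i \<le> j \<Longrightarrow> j \<le> CARD('n) \<Longrightarrow> lam i \<le> lam j"
    and v_lattice: "\<And>i. i \<in> {1..CARD('n)} \<Longrightarrow> v i \<in> int_lattice"
    and v_mem: "\<And>i. i \<in> {1..CARD('n)} \<Longrightarrow> v i \<in> (*\<^sub>R) (lam i) ` central_sym K"
    and v_new: "\<And>i. i \<in> {1..CARD('n)} \<Longrightarrow> v i \<notin> span (v ` {1..<i})"
    and short: "\<And>i r z. i \<in> {1..CARD('n)} \<Longrightarrow> 0 < r \<Longrightarrow> r < lam i
      \<Longrightarrow> z \<in> (*\<^sub>R) r ` central_sym K \<Longrightarrow> z \<in> int_lattice \<Longrightarrow> z \<in> span (v ` {1..<i})"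
begin

definition flag :: "nat \<Rightarrow> (real ^ 'n) set" where
  "flag k = span (v ` {1..k})"

text \<open>The parallelepiped is half-open so that the coefficients of a difference of two elements
  stay strictly below 1 in absolute value; this gives the strict inequality that
  \<open>short\<close> asks for.\<close>

definition cell :: "nat \<Rightarrow> (real ^ 'n) set" where
  "cell k = {\<Sum>j=1..k. s j *\<^sub>R v j | s. \<forall>j. 0 \<le> s j \<and> s j < 1}"

lemma flag_0: "flag 0 = {0}"
  by (simp add: flag_def)

lemma flag_less: "span (v ` {1..<Suc k}) = flag k"
  by (simp add: flag_def atLeastLessThanSuc_atLeastAtMost)

lemma subspace_flag: "subspace (flag k)"
  by (simp add: flag_def subspace_span)

lemma flag_mono: "flag k \<subseteq> flag (Suc k)"
  unfolding flag_def by (intro span_mono image_mono) auto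

lemma v_in_flag: "v (Suc k) \<in> flag (Suc k)"
  unfolding flag_def by (intro span_base) auto

lemma flag_Suc_cases:
  assumes "x \<in> flag (Suc k)"
  obtains a where "x - a *\<^sub>R v (Suc k) \<in> flag k"
proof -
  have "x \<in> span (insert (v (Suc k)) (v ` {1..k}))"
    using assms by (simp add: flag_def atLeastAtMostSuc_conv)
  then show ?thesis
    using that by (auto simp: span_insert flag_def)
qed

lemma flag_CARD: "flag CARD('n) = UNIV"
proof -
  have "(UNIV :: (real ^ 'n) set) \<subseteq> span (v ` {1..CARD('n)})"
    using independent_greedy[of "CARD('n)" v] v_new by (intro card_ge_dim_independent) auto
  then show ?thesis by (auto simp: flag_def)
qed

text \<open>Rounding down the coefficients with respect to the \<open>v j\<close> yields
  \<open>y\<close>. This lets lattice points be reduced modulo a flag space into a bounded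
  region.\<close>

lemma flag_near_lattice:
  assumes "k \<le> CARD('n)" "x \<in> flag k"
  shows "\<exists>y \<in> flag k \<inter> int_lattice. norm (x - y) \<le> (\<Sum>j=1..k. norm (v j))"
  using assms
proof (induction k arbitrary: x)
  case 0
  then show ?case by (simp add: flag_0)
next
  case (Suc k)
  obtain a where a: "x - a *\<^sub>R v (Suc k) \<in> flag k"
    using Suc.prems(2) by (rule flag_Suc_cases)
  then obtain y where y: "y \<in> flag k \<inter> int_lattice"
    "norm (x - a *\<^sub>R v (Suc k) - y) \<le> (\<Sum>j=1..k. norm (v j))"
    using Suc by fastforce
  let ?y = "of_int \<lfloor>a\<rfloor> *\<^sub>R v (Suc k) + y"
  have "?y \<in> flag (Suc k)"
    using y(1) flag_mono v_in_flag
    by (intro subspace_add subspace_scale subspace_flag) auto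
  moreover have "?y \<in> int_lattice"
    using y(1) v_lattice[of "Suc k"] Suc.prems(1)
    by (intro int_lattice_add int_lattice_scaleR) auto
  moreover have "norm (x - ?y) \<le> (\<Sum>j=1..Suc k. norm (v j))"
  proof -
    have "x - ?y = (x - a *\<^sub>R v (Suc k) - y) + (a - of_int \<lfloor>a\<rfloor>) *\<^sub>R v (Suc k)"
      by (simp add: algebra_simps)
    also have "norm \<dots> \<le> norm (x - a *\<^sub>R v (Suc k) - y) + \<bar>a - of_int \<lfloor>a\<rfloor>\<bar> * norm (v (Suc k))"
      by (metis norm_scaleR norm_triangle_ineq)
    also have "\<dots> \<le> (\<Sum>j=1..k. norm (v j)) + 1 * norm (v (Suc k))"
      using y(2) by (intro add_mono mult_right_mono norm_ge_zero) linarith+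
    finally show ?thesis by simp
  qed
  ultimately show ?case by blast
qed

text \<open>Let \<open>g\<close> be the coordinate along \<open>v (Suc k)\<close>. Its values at
  lattice points of the flag space have a least positive element \<open>d\<close>, with
  \<open>d \<le> 1\<close> because \<open>v (Suc k)\<close> is itself a lattice point. Then
  \<open>f = g / d\<close> numbers the lattice layers by integers, \<open>w\<close> lies in layer 1,
  and \<open>c = d\<close> makes \<open>c v (Suc k)\<close> exactly one layer high.\<close>

lemma layer_functional:
  assumes k: "Suc k \<le> CARD('n)"
  shows "\<exists>(f :: real ^ 'n \<Rightarrow> real) w c. linear f \<and> 0 < c \<and> c \<le> 1 \<and> w \<in> flag (Suc k) \<inter> int_lattice
    \<and> f w = 1 \<and> f (c *\<^sub>R v (Suc k)) = 1 \<and> (\<forall>x \<in> flag k. f x = 0)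
    \<and> (\<forall>x \<in> flag (Suc k). f x = 0 \<longrightarrow> x \<in> flag k)
    \<and> (\<forall>z \<in> flag (Suc k) \<inter> int_lattice. f z \<in> \<int>)"
proof -
  have new: "v (Suc k) \<notin> flag k"
    using v_new[of "Suc k"] k by (simp add: flag_less del: One_nat_def)
  obtain g :: "real ^ 'n \<Rightarrow> real" where g: "linear g"
    "\<forall>x \<in> v ` {1..Suc k}. g x = (if x = v (Suc k) then 1 else 0)"
    using linear_independent_extend[of "v ` {1..Suc k}"] independent_greedy[of "Suc k" v] v_new k
    by fastforce
  interpret g: linear g by (rule g(1))
  have g_v: "g (v (Suc k)) = 1" using g(2) by auto
  have g_flag: "g x = 0" if "x \<in> flag k" for x
  proof (rule linear_eq_0_on_span[OF g(1)])
    show "x \<in> span (v ` {1..k})" using that by (simp add: flag_def)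
    fix y assume "y \<in> v ` {1..k}"
    moreover have "y \<noteq> v (Suc k)"
      using calculation new span_base[of y "v ` {1..k}"] by (auto simp: flag_def)
    ultimately show "g y = 0" using g(2) by auto
  qed
  have g_ker: "x - g x *\<^sub>R v (Suc k) \<in> flag k" if "x \<in> flag (Suc k)" for x
  proof -
    obtain a where "x - a *\<^sub>R v (Suc k) \<in> flag k"
      using \<open>x \<in> flag (Suc k)\<close> by (rule flag_Suc_cases)
    moreover from g_flag[OF this] have "g x = a"
      by (simp add: g.diff g.scale g_v)
    ultimately show ?thesis by simp
  qed
  let ?M = "flag (Suc k) \<inter> int_lattice"
  define G where "G = g ` ?M \<inter> {0<..1}"
  define B where "B = norm (v (Suc k)) + (\<Sum>j=1..k. norm (v j))"
  \<comment> \<open>Subtracting a nearby lattice point of \<open>flag k\<close> leaves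
    \<open>g\<close> unchanged and moves \<open>z\<close> into a fixed ball. Hence only finitely
    many values occur in \<open>{0<..1}\<close>.\<close>
  have "G \<subseteq> g ` (cball 0 B \<inter> int_lattice)"
  proof
    fix a assume "a \<in> G"
    then obtain z where z: "z \<in> ?M" "a = g z" "0 < g z" "g z \<le> 1" by (auto simp: G_def)
    obtain y where y: "y \<in> flag k \<inter> int_lattice"
      "norm (z - g z *\<^sub>R v (Suc k) - y) \<le> (\<Sum>j=1..k. norm (v j))"
      using flag_near_lattice[OF _ g_ker[of z]] z(1) k by auto
    have "z - y = (z - g z *\<^sub>R v (Suc k) - y) + g z *\<^sub>R v (Suc k)" by simp
    also have "norm \<dots> \<le> norm (z - g z *\<^sub>R v (Suc k) - y) + \<bar>g z\<bar> * norm (v (Suc k))"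
      by (metis norm_scaleR norm_triangle_ineq)
    also have "\<dots> \<le> (\<Sum>j=1..k. norm (v j)) + 1 * norm (v (Suc k))"
      using y(2) z(3,4) by (intro add_mono mult_right_mono) auto
    finally have "z - y \<in> cball 0 B \<inter> int_lattice"
      using z(1) y(1) by (auto simp: B_def int_lattice_diff)
    moreover have "g (z - y) = a" using g_flag y(1) z(2) by (simp add: g.diff)
    ultimately show "a \<in> g ` (cball 0 B \<inter> int_lattice)" by blast
  qed
  then have "finite G"
    by (rule finite_subset) (intro finite_imageI finite_bounded_int_lattice bounded_cball)
  moreover have "1 \<in> G"
    using g_v v_in_flag[of k] v_lattice[of "Suc k"] k by (force simp: G_def)
  ultimately have "Min G \<in> G" and G_min: "\<And>a. a \<in> G \<Longrightarrow> Min G \<le> a"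
    by (auto intro: Min_in)
  define d where "d = Min G"
  obtain w where w: "w \<in> ?M" "g w = d" and d: "0 < d" "d \<le> 1"
    using \<open>Min G \<in> G\<close> by (auto simp: G_def d_def)
  \<comment> \<open>Division with remainder: a nonzero remainder would be a positive value of
    \<open>g\<close> at a lattice point smaller than \<open>d\<close>.\<close>
  have int: "g z / d \<in> \<int>" if z: "z \<in> ?M" for z
  proof (rule ccontr)
    assume notint: "g z / d \<notin> \<int>"
    let ?a = "of_int \<lfloor>g z / d\<rfloor> :: real"
    let ?r = "g z / d - ?a"
    have r: "0 < ?r" "?r < 1"
      using notint by (simp_all add: frac_def[symmetric] frac_lt_1 frac_gt_0_iff)
    have "z - ?a *\<^sub>R w \<in> flag (Suc k)"
      using z w(1) by (intro subspace_diff subspace_scale subspace_flag) auto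
    moreover have "z - ?a *\<^sub>R w \<in> int_lattice"
      using z w(1) by (intro int_lattice_diff int_lattice_scaleR) auto
    moreover have eq: "g (z - ?a *\<^sub>R w) = ?r * d"
      using d by (simp add: g.diff g.scale w(2) field_simps)
    moreover have "0 < ?r * d" "?r * d < d"
      using r d by simp_all
    ultimately have "?r * d \<in> G"
      using d(2) unfolding G_def by (intro IntI image_eqI[where f = g, OF eq[symmetric]]) auto
    then show False
      using G_min \<open>?r * d < d\<close> by (fastforce simp: d_def)
  qed
  have "linear (\<lambda>x. g x / d)"
    by (rule linearI) (simp_all add: g.add g.scale add_divide_distrib)
  moreover have "x \<in> flag k" if "x \<in> flag (Suc k)" "g x / d = 0" for x
    using g_ker[OF that(1)] that(2) d by simp
  ultimately show ?thesis
    using d w g_v g_flag int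
    by (intro exI[of _ "\<lambda>x. g x / d"] exI[of _ w] exI[of _ d]) (simp add: g.scale)
qed

section \<open>Half-open cells and the inductive count\<close>

lemma cell_add:
  assumes "p \<in> cell k" "0 \<le> a" "a < 1"
  shows "p + a *\<^sub>R v (Suc k) \<in> cell (Suc k)"
proof -
  obtain s where s: "p = (\<Sum>j=1..k. s j *\<^sub>R v j)" "\<forall>j. 0 \<le> s j \<and> s j < 1"
    using assms(1) by (auto simp: cell_def)
  have "p = (\<Sum>j=1..k. (s(Suc k := a)) j *\<^sub>R v j)"
    unfolding s(1) by (intro sum.cong) auto
  then have "p + a *\<^sub>R v (Suc k) = (\<Sum>j=1..Suc k. (s(Suc k := a)) j *\<^sub>R v j)"
    by simp
  moreover have "\<forall>j. 0 \<le> (s(Suc k := a)) j \<and> (s(Suc k := a)) j < 1"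
    using s(2) assms by simp
  ultimately show ?thesis
    unfolding cell_def by blast
qed

lemma cell_scale:
  assumes "p \<in> cell k" "0 \<le> a" "a \<le> 1"
  shows "a *\<^sub>R p \<in> cell k"
proof -
  obtain s where s: "p = (\<Sum>j=1..k. s j *\<^sub>R v j)" "\<forall>j. 0 \<le> s j \<and> s j < 1"
    using assms(1) by (auto simp: cell_def)
  have "a *\<^sub>R p = (\<Sum>j=1..k. (a * s j) *\<^sub>R v j)"
    by (simp add: s(1) scaleR_sum_right)
  moreover have "\<forall>j. 0 \<le> a * s j \<and> a * s j < 1"
    using s(2) assms by (meson mult_left_le_one_le mult_nonneg_nonneg order_le_less_trans)
  ultimately show ?thesis
    unfolding cell_def by (intro CollectI exI[of _ "\<lambda>j. a * s j"]) simp
qed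

text \<open>This fixes the choice of the dilation factor: \<open>x - x'\<close> lies in
  \<open>2 cs(K)\<close> and \<open>p - p'\<close> in \<open>r cs(K)\<close> with
  \<open>r < n \<lambda>\<close>, where \<open>\<lambda> = lam (Suc k)\<close>. So \<open>z\<close>
  lies in the dilate by \<open>t (2 + r) < t (2 + n \<lambda>) \<le> \<lambda>\<close>, and
  \<open>short\<close> applies.\<close>

lemma cell_difference_lattice:
  assumes k: "Suc k \<le> CARD('n)" and p: "p \<in> cell (Suc k)" "p' \<in> cell (Suc k)"
    and x: "x \<in> K" "x' \<in> K" and z: "z \<in> int_lattice"
    and t: "0 < t" "t \<le> 1 / (2 / lam (Suc k) + real CARD('n))"
    and eq: "z = t *\<^sub>R (x + p) - t *\<^sub>R (x' + p')"
  shows "z \<in> flag k"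
proof -
  let ?C = "central_sym K" and ?l = "lam (Suc k)"
  have l: "0 < ?l" using lam_pos k by simp
  have C: "convex ?C" "0 \<in> ?C"
    using convex_central_sym[OF convex_K] K_nonempty by (auto simp: central_sym_def)
  obtain s s' where s: "p = (\<Sum>j=1..Suc k. s j *\<^sub>R v j)" "\<And>j. 0 \<le> s j \<and> s j < 1"
    and s': "p' = (\<Sum>j=1..Suc k. s' j *\<^sub>R v j)" "\<And>j. 0 \<le> s' j \<and> s' j < 1"
    using p unfolding cell_def by blast
  define r where "r = (\<Sum>j=1..Suc k. \<bar>s j - s' j\<bar> * lam j)"
  have "(\<Sum>j=1..Suc k. (s j - s' j) *\<^sub>R v j) \<in> (*\<^sub>R) r ` ?C"
    unfolding r_def
  proof (intro convex_dilate_sum C symmetric_dilate_scaleR v_mem central_sym_uminus)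
    show "0 \<le> \<bar>s j - s' j\<bar> * lam j" if "j \<in> {1..Suc k}" for j
      using lam_pos[of j] that k by simp
  qed (use k in auto)
  also have "(\<Sum>j=1..Suc k. (s j - s' j) *\<^sub>R v j) = p - p'"
    by (simp only: s(1) s'(1) scaleR_diff_left sum_subtractf)
  finally have pp: "p - p' \<in> (*\<^sub>R) r ` ?C" .
  have "r < (\<Sum>j=1..Suc k. ?l)"
    unfolding r_def
  proof (intro sum_strict_mono)
    fix j assume j: "j \<in> {1..Suc k}"
    have "\<bar>s j - s' j\<bar> < 1" using s(2)[of j] s'(2)[of j] by linarith
    then have "\<bar>s j - s' j\<bar> * lam j < 1 * lam j"
      using lam_pos[of j] j k by (intro mult_strict_right_mono) auto
    also have "\<dots> \<le> ?l" using lam_mono[of j "Suc k"] j k by simp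
    finally show "\<bar>s j - s' j\<bar> * lam j < ?l" .
  qed auto
  also have "\<dots> = real (Suc k) * ?l" by simp
  \<comment> \<open>Replacing \<open>Suc k\<close> by the dimension produces the summand
    \<open>n\<close> that is common to all factors of the bound.\<close>
  also have "\<dots> \<le> real CARD('n) * ?l"
    using k l by (intro mult_right_mono) auto
  finally have r: "r < real CARD('n) * ?l" .
  have r0: "0 \<le> r"
    unfolding r_def using lam_pos k by (intro sum_nonneg mult_nonneg_nonneg) (auto simp: less_imp_le)
  have "(x - x') + (p - p') \<in> (*\<^sub>R) (2 + r) ` ?C"
    using r0 by (intro convex_dilate_add C diff_mem_dilate_central_sym x pp) auto
  then have "t *\<^sub>R ((x - x') + (p - p')) \<in> (*\<^sub>R) (t * (2 + r)) ` ?C"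
    by auto
  moreover have "z = t *\<^sub>R ((x - x') + (p - p'))"
    by (simp add: eq algebra_simps)
  moreover have "t * (2 + r) < ?l"
  proof -
    have "t * (2 + r) < t * (2 + real CARD('n) * ?l)"
      using t(1) r by simp
    also have "\<dots> \<le> 1 / (2 / ?l + real CARD('n)) * (2 + real CARD('n) * ?l)"
      using t l by (intro mult_right_mono) auto
    also have "\<dots> = ?l"
    proof -
      have "2 + real CARD('n) * ?l = ?l * (2 / ?l + real CARD('n))"
        using l by (simp add: field_simps)
      moreover have "2 / ?l + real CARD('n) \<noteq> 0"
        using l by (intro less_imp_neq[symmetric] add_pos_nonneg) auto
      ultimately show ?thesis by simp
    qed
    finally show ?thesis .
  qed
  moreover have "0 < t * (2 + r)" using t r0 by simp
  ultimately show ?thesis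
    using short[of "Suc k" "t * (2 + r)" z] k z flag_less by simp
qed

text \<open>The factor \<open>T\<close> and the real shift \<open>\<tau>\<close> are left arbitrary
  because the induction hypothesis is applied to each layer with a smaller factor and with a shift
  depending on the layer and on its target height.\<close>

lemma incongruent_points:
  assumes "N > 0" "k \<le> CARD('n)" "T > 0"
    and "\<And>j. j \<in> {1..k} \<Longrightarrow> real N / (2 / lam j + real CARD('n)) \<le> T"
    and "finite X" "X \<subseteq> K \<inter> int_lattice" "\<And>x. x \<in> X \<Longrightarrow> T *\<^sub>R x + \<tau> \<in> flag k"
  shows "\<exists>Y. finite Y \<and> Y \<subseteq> flag k \<inter> int_lattice
    \<and> (\<forall>y\<in>Y. \<exists>x \<in> convex hull X. \<exists>p \<in> cell k. y = T *\<^sub>R (x + p) + \<tau>)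
    \<and> (\<forall>y\<in>Y. \<forall>y'\<in>Y. \<forall>z\<in>int_lattice. y - y' = real N *\<^sub>R z \<longrightarrow> y = y')
    \<and> card X * (\<Prod>j=1..k. nat \<lfloor>real N / (2 / lam j + real CARD('n))\<rfloor>) \<le> card Y"
  using assms
proof (induction k arbitrary: T X \<tau>)
  case 0
  \<comment> \<open>Since \<open>flag 0\<close> is trivial and \<open>T > 0\<close>, at most one
    point \<open>x\<close> is possible, so \<open>Y\<close> is empty or \<open>{0}\<close>.\<close>
  have eq: "T *\<^sub>R x + \<tau> = 0" if "x \<in> X" for x
    using 0 that by (auto simp: flag_0)
  show ?case
  proof (cases "X = {}")
    case True
    then show ?thesis by (intro exI[of _ "{}"]) simp
  next
    case False
    then obtain x0 where x0: "x0 \<in> X" by blast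
    have "x = x0" if "x \<in> X" for x
      using eq[OF that] eq[OF x0] \<open>T > 0\<close> by (metis add_right_cancel less_irrefl scaleR_left_imp_eq)
    then have "X = {x0}" using x0 by blast
    moreover have "0 \<in> cell 0" by (auto simp: cell_def intro!: exI[of _ "\<lambda>_. 0"])
    ultimately show ?thesis
      using eq[OF x0] by (intro exI[of _ "{0}"]) (auto simp: flag_0 intro!: bexI[of _ 0])
  qed
next
  case (Suc k)
  show ?case
  proof (cases "X = {}")
    case True
    then show ?thesis by (intro exI[of _ "{}"]) simp
  next
    case False
    then obtain x0 where x0: "x0 \<in> X" by blast
    let ?L = "flag (Suc k)" and ?n = "real CARD('n)"
    let ?\<Pi> = "\<Prod>j=1..k. nat \<lfloor>real N / (2 / lam j + ?n)\<rfloor>"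
    obtain f :: "real ^ 'n \<Rightarrow> real" and w c where f: "linear f" and c: "0 < c" "c \<le> 1"
      and w: "w \<in> ?L \<inter> int_lattice" "f w = 1" and f_v: "f (c *\<^sub>R v (Suc k)) = 1"
      and f_flag: "\<And>x. x \<in> flag k \<Longrightarrow> f x = 0"
      and f_ker: "\<And>x. x \<in> ?L \<Longrightarrow> f x = 0 \<Longrightarrow> x \<in> flag k"
      and f_int: "\<And>z. z \<in> ?L \<inter> int_lattice \<Longrightarrow> f z \<in> \<int>"
      using layer_functional[OF Suc.prems(2)] by blast
    interpret f: linear f by (rule f)
    \<comment> \<open>The dilation factor of this level. It is at most \<open>T\<close>, and by
      monotonicity of \<open>lam\<close> it dominates the factors of all lower levels, as the
      induction hypothesis requires.\<close>
    define S where "S = real N / (2 / lam (Suc k) + ?n)"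
    have lam: "0 < lam (Suc k)" using lam_pos Suc.prems(2) by simp
    have S: "0 < S" "S \<le> T"
      using lam \<open>N > 0\<close> Suc.prems(4)[of "Suc k"] by (auto simp: S_def intro!: divide_pos_pos add_pos_pos)
    have S_ge: "real N / (2 / lam j + ?n) \<le> S" if "j \<in> {1..k}" for j
      unfolding S_def using lam_mono[of j "Suc k"] lam_pos[of j] that Suc.prems(2) lam
      by (intro divide_left_mono add_mono mult_pos_pos add_pos_pos) auto
    \<comment> \<open>Absorbs the passage from the dilation factor \<open>T\<close> to \<open>S\<close>, since
      \<open>S x + (T - S) x0\<close> is \<open>T\<close> times a convex combination of \<open>x\<close> and \<open>x0\<close>.\<close>
    define \<rho> where "\<rho> = (T - S) *\<^sub>R x0 + \<tau>"
    have diff_flag: "x - x0 \<in> ?L" if "x \<in> X" for x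
    proof -
      have "(1 / T) *\<^sub>R ((T *\<^sub>R x + \<tau>) - (T *\<^sub>R x0 + \<tau>)) \<in> ?L"
        using Suc.prems(7) that x0
        by (intro subspace_scale subspace_diff subspace_flag) auto
      then show ?thesis
        using Suc.prems(3) by (simp add: scaleR_diff_right[symmetric])
    qed
    have \<rho>_flag: "S *\<^sub>R x + \<rho> \<in> ?L" if "x \<in> X" for x
    proof -
      have "(T *\<^sub>R x + \<tau>) - (T - S) *\<^sub>R (x - x0) \<in> ?L"
        by (rule subspace_diff[OF subspace_flag Suc.prems(7)[OF that]
            subspace_scale[OF subspace_flag diff_flag[OF that]]])
      then show ?thesis
        by (simp add: \<rho>_def algebra_simps)
    qed
    \<comment> \<open>The layer index is measured from \<open>x0\<close> because \<open>X\<close>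
      lies in a coset of the flag space: only differences are lattice points of the space itself,
      where \<open>f\<close> is integral.\<close>
    define m where "m x = \<lfloor>f (x - x0)\<rfloor>" for x
    have m: "f (x - x0) = of_int (m x)" if "x \<in> X" for x
    proof -
      have "x - x0 \<in> int_lattice"
        using Suc.prems(6) that x0 by (intro int_lattice_diff) auto
      then show ?thesis
        using f_int[of "x - x0"] diff_flag[OF that] by (simp add: m_def)
    qed
    define \<sigma> where "\<sigma> = f (S *\<^sub>R x0 + \<rho>)"
    have f_layer: "f (S *\<^sub>R x + \<rho>) = S * of_int (m x) + \<sigma>" if "x \<in> X" for x
      using m[OF that] by (simp add: \<sigma>_def f.add f.scale f.diff algebra_simps)
    define q where "q = nat \<lfloor>S\<rfloor>"
    \<comment> \<open>The \<open>q\<close> consecutive integers starting at this ceiling all lie in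
      the half-open interval of length \<open>S\<close> from \<open>S a + \<sigma>\<close>: they are
      heights of lattice layers met by the dilate of the thickened layer \<open>a\<close>.\<close>
    define H where "H a = {\<lceil>S * of_int a + \<sigma>\<rceil> ..< \<lceil>S * of_int a + \<sigma>\<rceil> + int q}" for a :: int
    have H: "S * of_int a + \<sigma> \<le> of_int h" "of_int h < S * of_int a + \<sigma> + S" if "h \<in> H a" for a h
    proof -
      have "\<lceil>S * of_int a + \<sigma>\<rceil> \<le> h" "h \<le> \<lceil>S * of_int a + \<sigma>\<rceil> + \<lfloor>S\<rfloor> - 1"
        using that S(1) by (auto simp: H_def q_def)
      then show "S * of_int a + \<sigma> \<le> of_int h" "of_int h < S * of_int a + \<sigma> + S"
        by linarith+
    qed
    \<comment> \<open>The fraction of \<open>c v (Suc k)\<close> that lifts layer \<open>a\<close>,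
      after dilation by \<open>S\<close>, from height \<open>S a + \<sigma>\<close> to height
      \<open>h\<close>.\<close>
    define \<theta> where "\<theta> a h = (of_int h - S * of_int a - \<sigma>) / S" for a h :: int
    have \<theta>: "0 \<le> \<theta> a h" "\<theta> a h < 1" if "h \<in> H a" for a h
      using H[OF that] S(1) by (simp_all add: \<theta>_def field_simps)
    \<comment> \<open>After the lift to height \<open>h\<close>, the lattice vector
      \<open>h w\<close> of the same height is subtracted, so the layer lands in
      \<open>flag k\<close>. The map \<open>g\<close> below adds \<open>h w\<close> back.\<close>
    define \<tau>' where "\<tau>' a h = \<rho> + (S * \<theta> a h * c) *\<^sub>R v (Suc k) - of_int h *\<^sub>R w" for a h
    define X' where "X' a = {x \<in> X. m x = a}" for a
    have "\<exists>Y. finite Y \<and> Y \<subseteq> flag k \<inter> int_lattice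
      \<and> (\<forall>y\<in>Y. \<exists>x \<in> convex hull X' a. \<exists>p \<in> cell k. y = S *\<^sub>R (x + p) + \<tau>' a h)
      \<and> (\<forall>y\<in>Y. \<forall>y'\<in>Y. \<forall>z\<in>int_lattice. y - y' = real N *\<^sub>R z \<longrightarrow> y = y')
      \<and> card (X' a) * ?\<Pi> \<le> card Y" for a h
    proof (rule Suc.IH)
      fix x assume "x \<in> X' a"
      then have x: "x \<in> X" "m x = a" by (auto simp: X'_def)
      have "(S *\<^sub>R x + \<rho>) + (S * \<theta> a h * c) *\<^sub>R v (Suc k) - of_int h *\<^sub>R w \<in> ?L"
        by (rule subspace_diff subspace_add subspace_scale subspace_flag \<rho>_flag[OF x(1)]
            v_in_flag IntD1[OF w(1)])+
      then have "S *\<^sub>R x + \<tau>' a h \<in> ?L" by (simp add: \<tau>'_def algebra_simps)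
      moreover have "f (S *\<^sub>R x + \<tau>' a h) = 0"
      proof -
        have "f (S *\<^sub>R x + \<tau>' a h) = f (S *\<^sub>R x + \<rho>) + S * \<theta> a h * f (c *\<^sub>R v (Suc k)) - of_int h * f w"
          by (simp add: \<tau>'_def f.add f.diff f.scale)
        then show ?thesis
          using S(1) by (simp add: f_layer[OF x(1)] f_v w(2) x(2) \<theta>_def)
      qed
      ultimately show "S *\<^sub>R x + \<tau>' a h \<in> flag k" by (rule f_ker)
    qed (use Suc.prems S S_ge in \<open>auto simp: X'_def\<close>)
    then obtain Y where Y_fin: "\<And>a h. finite (Y a h)"
      and Y_sub: "\<And>a h. Y a h \<subseteq> flag k \<inter> int_lattice"
      and Y_ex: "\<And>a h y. y \<in> Y a h
        \<Longrightarrow> \<exists>x \<in> convex hull X' a. \<exists>p \<in> cell k. y = S *\<^sub>R (x + p) + \<tau>' a h"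
      and Y_inc: "\<And>a h y y' z. y \<in> Y a h \<Longrightarrow> y' \<in> Y a h \<Longrightarrow> z \<in> int_lattice
        \<Longrightarrow> y - y' = real N *\<^sub>R z \<Longrightarrow> y = y'"
      and Y_card: "\<And>a h. card (X' a) * ?\<Pi> \<le> card (Y a h)"
      by metis
    define I where "I = Sigma (m ` X) H"
    define Z where "Z = Sigma I (\<lambda>(a, h). Y a h)"
    define g where "g = (\<lambda>((a :: int, h :: int), y). y + of_int h *\<^sub>R w)"
    have hull: "convex hull X' a \<subseteq> convex hull X" for a
      by (intro hull_mono) (auto simp: X'_def)
    have hull_K: "convex hull X \<subseteq> K"
      using Suc.prems(6) convex_K by (intro hull_minimal) auto
    \<comment> \<open>Since \<open>\<theta> c < 1\<close>, the lift is absorbed as the last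
      coefficient of an element of \<open>cell (Suc k)\<close>.\<close>
    have g_ex: "\<exists>x \<in> convex hull X. \<exists>p \<in> cell (Suc k). y + of_int h *\<^sub>R w = S *\<^sub>R (x + p) + \<rho>"
      if "h \<in> H a" "y \<in> Y a h" for a h y
    proof -
      obtain x p where xp: "x \<in> convex hull X' a" "p \<in> cell k" "y = S *\<^sub>R (x + p) + \<tau>' a h"
        using Y_ex[OF \<open>y \<in> Y a h\<close>] by blast
      have "\<theta> a h * c < 1"
        using \<theta>[OF that(1)] c by (meson mult_left_le order_le_less_trans)
      then have "p + (\<theta> a h * c) *\<^sub>R v (Suc k) \<in> cell (Suc k)"
        using \<theta>[OF that(1)] c xp(2) by (intro cell_add) auto
      moreover have "y + of_int h *\<^sub>R w = S *\<^sub>R (x + (p + (\<theta> a h * c) *\<^sub>R v (Suc k))) + \<rho>"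
        by (simp add: xp(3) \<tau>'_def algebra_simps)
      ultimately show ?thesis
        using xp(1) hull by blast
    qed
    \<comment> \<open>Serves both injectivity of \<open>g\<close> (with \<open>z = 0\<close>) and
      incongruence. First \<open>z\<close> lies in \<open>flag k\<close>, so \<open>f\<close> gives
      equal heights; then the layers agree; then the induction hypothesis settles
      \<open>y = y'\<close>.\<close>
    have sep: "a = a' \<and> h = h' \<and> y = y'"
      if h: "h \<in> H a" "h' \<in> H a'" and y: "y \<in> Y a h" "y' \<in> Y a' h'" and z: "z \<in> int_lattice"
        and eq: "(y + of_int h *\<^sub>R w) - (y' + of_int h' *\<^sub>R w) = real N *\<^sub>R z"
      for a a' h h' y y' z
    proof -
      obtain x p where xp: "x \<in> convex hull X" "p \<in> cell (Suc k)"
        "y + of_int h *\<^sub>R w = S *\<^sub>R (x + p) + \<rho>" using g_ex[OF h(1) y(1)] by blast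
      obtain x' p' where xp': "x' \<in> convex hull X" "p' \<in> cell (Suc k)"
        "y' + of_int h' *\<^sub>R w = S *\<^sub>R (x' + p') + \<rho>" using g_ex[OF h(2) y(2)] by blast
      have "z \<in> flag k"
      proof (rule cell_difference_lattice)
        have "z = (1 / real N) *\<^sub>R (real N *\<^sub>R z)" using \<open>N > 0\<close> by simp
        also have "\<dots> = (1 / real N) *\<^sub>R (S *\<^sub>R (x + p) - S *\<^sub>R (x' + p'))"
          unfolding eq[symmetric] xp(3) xp'(3) by simp
        finally show "z = (S / real N) *\<^sub>R (x + p) - (S / real N) *\<^sub>R (x' + p')"
          by (simp add: scaleR_diff_right)
        show "S / real N \<le> 1 / (2 / lam (Suc k) + ?n)"
          using \<open>N > 0\<close> by (simp add: S_def)
      qed (use Suc.prems(2) xp xp' hull_K z S(1) \<open>N > 0\<close> in auto)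
      then have "f z = 0" by (rule f_flag)
      moreover have "f y = 0" "f y' = 0" using y Y_sub f_flag by blast+
      moreover have "f y + of_int h * f w - (f y' + of_int h' * f w) = real N * f z"
        using arg_cong[OF eq, of f] by (simp add: f.add f.diff f.scale)
      ultimately have hh: "h = h'" using w(2) by simp
      \<comment> \<open>The common height lies in the half-open intervals of length \<open>S\<close>
        belonging to \<open>a\<close> and to \<open>a'\<close>, which are disjoint unless
        \<open>a = a'\<close>.\<close>
      have "S * of_int a < S * (of_int a' + 1)" "S * of_int a' < S * (of_int a + 1)"
        using H[OF h(1)] H[OF h(2)] hh by (auto simp: algebra_simps)
      then have "real_of_int a < of_int a' + 1" "real_of_int a' < of_int a + 1"
        using S(1) by (simp_all only: mult_less_cancel_left_pos)
      then have "a = a'" by linarith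
      moreover have "y = y'"
        using Y_inc[of y a h y' z] y z eq hh calculation by simp
      ultimately show ?thesis using hh by simp
    qed
    have Z_iff: "((a, h), y) \<in> Z \<longleftrightarrow> a \<in> m ` X \<and> h \<in> H a \<and> y \<in> Y a h" for a h y
      by (auto simp: Z_def I_def)
    have I_fin: "finite I"
      using Suc.prems(5) by (auto simp: I_def H_def)
    have Z_fin: "finite Z"
      using I_fin Y_fin by (auto simp: Z_def)
    have g_inj: "inj_on g Z"
    proof (rule inj_onI)
      fix u u' assume u: "u \<in> Z" "u' \<in> Z" "g u = g u'"
      obtain a h y where 1: "u = ((a, h), y)" by (metis prod.exhaust)
      obtain a' h' y' where 2: "u' = ((a', h'), y')" by (metis prod.exhaust)
      show "u = u'"
        using u sep[of h a h' a' y y' 0] by (simp add: 1 2 Z_iff g_def)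
    qed
    have "card X * (?\<Pi> * q) = (\<Sum>a\<in>m ` X. card (X' a)) * (?\<Pi> * q)"
      using sum.image_gen[OF Suc.prems(5), of "\<lambda>_. 1 :: nat" m] by (simp add: X'_def)
    also have "\<dots> = (\<Sum>a\<in>m ` X. \<Sum>h\<in>H a. card (X' a) * ?\<Pi>)"
      by (simp add: H_def sum_distrib_right sum_distrib_left algebra_simps)
    also have "\<dots> = (\<Sum>(a, h)\<in>I. card (X' a) * ?\<Pi>)"
      unfolding I_def using Suc.prems(5) by (intro sum.Sigma) (auto simp: H_def)
    also have "\<dots> \<le> (\<Sum>(a, h)\<in>I. card (Y a h))"
      by (intro sum_mono) (use Y_card in auto)
    also have "\<dots> = card Z"
      unfolding Z_def using I_fin Y_fin by (subst card_SigmaI) (auto simp: case_prod_unfold)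
    also have "\<dots> = card (g ` Z)"
      using g_inj by (simp add: card_image)
    finally have card: "card X * (\<Prod>j=1..Suc k. nat \<lfloor>real N / (2 / lam j + ?n)\<rfloor>) \<le> card (g ` Z)"
      by (simp add: q_def S_def)
    show ?thesis
    proof (intro exI[of _ "g ` Z"] conjI ballI impI)
      show "finite (g ` Z)" using Z_fin by simp
      show "g ` Z \<subseteq> ?L \<inter> int_lattice"
      proof clarify
        fix a h y assume "((a, h), y) \<in> Z"
        then have "y \<in> ?L" "y \<in> int_lattice"
          using subsetD[OF Y_sub[of a h], of y] subsetD[OF flag_mono[of k], of y] by (auto simp: Z_iff)
        then show "g ((a, h), y) \<in> ?L \<inter> int_lattice"
          using w(1) unfolding g_def prod.case
          by (intro IntI int_lattice_add int_lattice_scaleR subspace_add subspace_scale subspace_flag)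
            auto
      qed
    next
      fix y assume "y \<in> g ` Z"
      then obtain x p where xp: "x \<in> convex hull X" "p \<in> cell (Suc k)" "y = S *\<^sub>R (x + p) + \<rho>"
        using g_ex by (fastforce simp: g_def Z_iff)
      have "(S / T) *\<^sub>R x + (1 - S / T) *\<^sub>R x0 \<in> convex hull X"
        using xp(1) x0 S Suc.prems(3)
        by (intro convexD[OF convex_convex_hull] hull_inc[OF x0]) auto
      moreover have "(S / T) *\<^sub>R p \<in> cell (Suc k)"
        using xp(2) S Suc.prems(3) by (intro cell_scale) auto
      moreover have "y = T *\<^sub>R (((S / T) *\<^sub>R x + (1 - S / T) *\<^sub>R x0) + (S / T) *\<^sub>R p) + \<tau>"
      proof -
        have "T * (1 - S / T) = T - S" "T * (S / T) = S"
          using Suc.prems(3) by (simp_all add: field_simps)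
        then show ?thesis
          unfolding xp(3) \<rho>_def scaleR_add_right scaleR_scaleR by simp
      qed
      ultimately show "\<exists>x \<in> convex hull X. \<exists>p \<in> cell (Suc k). y = T *\<^sub>R (x + p) + \<tau>"
        by blast
    next
      fix y y' z assume y: "y \<in> g ` Z" "y' \<in> g ` Z" and z: "z \<in> int_lattice" "y - y' = real N *\<^sub>R z"
      obtain a h u where 1: "((a, h), u) \<in> Z" "y = u + of_int h *\<^sub>R w"
        using y(1) by (auto simp: g_def)
      obtain a' h' u' where 2: "((a', h'), u') \<in> Z" "y' = u' + of_int h' *\<^sub>R w"
        using y(2) by (auto simp: g_def)
      show "y = y'"
        using sep[of h a h' a' u u' z] 1 2 z by (simp add: Z_iff)
    qed (rule card)
  qed
qed

text \<open>At \<open>k = n\<close> the flag is the whole space, so \<open>T = N\<close> and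
  \<open>\<tau> = 0\<close> are allowed; \<open>N\<close> dominates every factor because each
  denominator is at least 1. The points obtained are then counted modulo \<open>N\<close>.\<close>

lemma card_lattice_mult_le:
  assumes "bounded K" "N > 0"
  shows "card (K \<inter> int_lattice)
    * (\<Prod>j=1..CARD('n). nat \<lfloor>real N / (2 / lam j + real CARD('n))\<rfloor>) \<le> N ^ CARD('n)"
proof -
  let ?q = "\<Prod>j=1..CARD('n). nat \<lfloor>real N / (2 / lam j + real CARD('n))\<rfloor>"
  have "\<exists>Y. finite Y \<and> Y \<subseteq> flag CARD('n) \<inter> int_lattice
    \<and> (\<forall>y\<in>Y. \<exists>x \<in> convex hull (K \<inter> int_lattice). \<exists>p \<in> cell CARD('n). y = real N *\<^sub>R (x + p) + 0)
    \<and> (\<forall>y\<in>Y. \<forall>y'\<in>Y. \<forall>z\<in>int_lattice. y - y' = real N *\<^sub>R z \<longrightarrow> y = y')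
    \<and> card (K \<inter> int_lattice) * ?q \<le> card Y"
  proof (rule incongruent_points)
    fix j assume "j \<in> {1..CARD('n)}"
    then have "0 < lam j" by (rule lam_pos)
    then have "1 \<le> 2 / lam j + real CARD('n)"
      by (metis One_nat_def Suc_leI add.commute add_increasing2 divide_nonneg_pos of_nat_1 of_nat_le_iff
          zero_le_numeral zero_less_card_finite)
    then show "real N / (2 / lam j + real CARD('n)) \<le> real N"
      by (simp add: divide_le_eq mult_le_cancel_left1)
  qed (use assms finite_bounded_int_lattice flag_CARD in auto)
  then obtain Y where Y: "Y \<subseteq> flag CARD('n) \<inter> int_lattice"
    "\<forall>y\<in>Y. \<forall>y'\<in>Y. \<forall>z\<in>int_lattice. y - y' = real N *\<^sub>R z \<longrightarrow> y = y'"
    "card (K \<inter> int_lattice) * ?q \<le> card Y"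
    by (elim exE conjE)
  have "card Y \<le> N ^ CARD('n)"
    by (rule card_incongruent_le[OF assms(2)]) (use Y(1,2) in blast)+
  with Y(3) show ?thesis by (rule le_trans)
qed

end

section \<open>Passage to the limit in \<open>N\<close>\<close>

lemma tendsto_nat_floor_divide:
  assumes "t \<ge> 0"
  shows "(\<lambda>N. real (nat \<lfloor>real N * t\<rfloor>) / real N) \<longlonglongrightarrow> t"
proof (rule tendsto_sandwich)
  show "\<forall>\<^sub>F N in sequentially. t - 1 / real N \<le> real (nat \<lfloor>real N * t\<rfloor>) / real N"
    using eventually_gt_at_top[of 0]
  proof eventually_elim
    case (elim N)
    have "real N * t - 1 \<le> real (nat \<lfloor>real N * t\<rfloor>)" using assms by linarith
    then have "(real N * t - 1) / real N \<le> real (nat \<lfloor>real N * t\<rfloor>) / real N"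
      by (rule divide_right_mono) simp
    then show ?case using elim by (simp add: diff_divide_distrib)
  qed
  show "\<forall>\<^sub>F N in sequentially. real (nat \<lfloor>real N * t\<rfloor>) / real N \<le> t"
    using eventually_gt_at_top[of 0]
  proof eventually_elim
    case (elim N)
    have "real (nat \<lfloor>real N * t\<rfloor>) \<le> real N * t" using assms by simp
    then show ?case using elim by (simp add: field_simps)
  qed
  show "(\<lambda>N. t - 1 / real N) \<longlonglongrightarrow> t"
    using tendsto_diff[OF tendsto_const lim_1_over_n, of t] by simp
qed simp

theorem corollary1p2:
  fixes K :: "(real ^ 'n) set"
  assumes "convex_body K"
  shows "real (lattice_count K)
    \<le> (\<Prod>i = 1..CARD('n). 2 / succ_min i K + real CARD('n))"
proof -
  let ?C = "central_sym K" and ?n = "CARD('n)"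
  have K: "compact K" "convex K" "interior K \<noteq> {}"
    using assms by (auto simp: convex_body_def)
  have C: "compact ?C" "convex ?C" "0 \<in> interior ?C"
    using K by (auto intro: compact_central_sym convex_central_sym zero_in_interior_central_sym)
  define lam where "lam i = succ_min i K" for i
  have least: "0 < lam i" "i \<le> dim ((*\<^sub>R) (lam i) ` ?C \<inter> int_lattice)"
    "\<And>t. 0 < t \<Longrightarrow> i \<le> dim ((*\<^sub>R) t ` ?C \<inter> int_lattice) \<Longrightarrow> lam i \<le> t"
    if "i \<in> {1..?n}" for i
    using succ_min_sym_least[OF C, of i] that by (auto simp: lam_def succ_min_def)
  obtain v where v: "\<And>i. i \<in> {1..?n} \<Longrightarrow> v i \<in> (*\<^sub>R) (lam i) ` ?C"
    "\<And>i. i \<in> {1..?n} \<Longrightarrow> v i \<in> int_lattice" "\<And>i. i \<in> {1..?n} \<Longrightarrow> v i \<notin> span (v ` {1..<i})"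
    using succ_min_sym_vectors[OF C order_refl] unfolding lam_def succ_min_def by blast
  have short: "z \<in> span (v ` {1..<i})"
    if i: "i \<in> {1..?n}" and r: "0 < r" "r < lam i"
      and z: "z \<in> (*\<^sub>R) r ` ?C" "z \<in> int_lattice" for i r z
  proof -
    let ?D = "(*\<^sub>R) r ` ?C \<inter> int_lattice"
    \<comment> \<open>For \<open>l < i\<close> the value \<open>lam l\<close> may exceed
      \<open>r\<close>, so \<open>v l\<close> need not lie in \<open>?D\<close>. Below the first
      index \<open>j\<close> with \<open>lam j > r\<close> all of them do; there are
      \<open>j - 1\<close> of them, independent, while \<open>dim ?D < j\<close>, so they span
      \<open>?D\<close>.\<close>
    define j where "j = (LEAST j. 1 \<le> j \<and> r < lam j)"
    have j: "1 \<le> j" "r < lam j" "j \<le> i" "\<And>l. 1 \<le> l \<Longrightarrow> l < j \<Longrightarrow> lam l \<le> r"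
      using LeastI[of "\<lambda>j. 1 \<le> j \<and> r < lam j" i] Least_le[of "\<lambda>j. 1 \<le> j \<and> r < lam j" i]
        not_less_Least[of _ "\<lambda>j. 1 \<le> j \<and> r < lam j"] i r
      unfolding j_def by (auto simp: not_less)
    have "v ` {1..<j} \<subseteq> ?D"
    proof clarify
      fix l assume l: "l \<in> {1..<j}"
      then have "v l \<in> (*\<^sub>R) (lam l) ` ?C" "v l \<in> int_lattice" "0 < lam l" "lam l \<le> r"
        using v least(1) j i by auto
      then show "v l \<in> ?D"
        using convex_dilate_mono[OF C(2), of "lam l" r] C(3) interior_subset by fastforce
    qed
    moreover have "independent (v ` {1..<j}) \<and> card (v ` {1..<j}) = j - 1"
    proof -
      have "{1..<j} = {1..j - 1}" using j(1) by auto
      then show ?thesis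
        using independent_greedy[of "j - 1" v] v(3) j i by auto
    qed
    moreover have "dim ?D < j"
      using least(3)[of j r] j i r(1) by force
    ultimately have "?D \<subseteq> span (v ` {1..<j})"
      by (intro card_ge_dim_independent) auto
    also have "\<dots> \<subseteq> span (v ` {1..<i})"
      using j(3) by (intro span_mono image_mono) auto
    finally show ?thesis using z by blast
  qed
  interpret minima_vectors K lam v
  proof
    show "K \<noteq> {}" using K(3) by auto
    \<comment> \<open>The dilate by \<open>lam j\<close> has lattice dimension at least
      \<open>j\<close>, hence at least \<open>i\<close>, so \<open>lam j\<close> is admissible for
      \<open>i\<close>.\<close>
    show "lam i \<le> lam j" if "1 \<le> i" "i \<le> j" "j \<le> CARD('n)" for i j
      using least(1,2)[of j] least(3)[of i "lam j"] that by auto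
  qed (use K least(1) v short in auto)
  define t where "t j = 1 / (2 / lam j + real ?n)" for j
  define P where "P = (\<Prod>j=1..?n. 2 / lam j + real ?n)"
  have pos: "0 < 2 / lam j + real ?n" if "j \<in> {1..?n}" for j
    using lam_pos[OF that] by (simp add: add_pos_pos)
  have P: "0 < P" unfolding P_def using pos by (intro prod_pos) auto
  let ?G = "real (card (K \<inter> int_lattice))"
  \<comment> \<open>The counting inequality divided by \<open>N ^ n\<close>, one \<open>N\<close>
    going to each factor.\<close>
  let ?s = "\<lambda>N. ?G * (\<Prod>j=1..?n. real (nat \<lfloor>real N * t j\<rfloor>) / real N)"
  have "?s \<longlonglongrightarrow> ?G * (\<Prod>j=1..?n. t j)"
    using pos by (intro tendsto_intros tendsto_nat_floor_divide) (auto simp: t_def less_imp_le)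
  moreover have "\<forall>\<^sub>F N in sequentially. ?s N \<le> 1"
    using eventually_gt_at_top[of 0]
  proof eventually_elim
    case (elim N)
    have "real (card (K \<inter> int_lattice) * (\<Prod>j=1..?n. nat \<lfloor>real N * t j\<rfloor>)) \<le> real (N ^ ?n)"
      using card_lattice_mult_le[OF compact_imp_bounded[OF K(1)] elim] by (simp add: t_def del: of_nat_power of_nat_mult)
    then show ?case
      using elim by (simp add: prod_dividef divide_le_eq)
  qed
  ultimately have "?G * (\<Prod>j=1..?n. t j) \<le> 1"
    by (intro tendsto_upperbound) auto
  moreover have "(\<Prod>j=1..?n. t j) = 1 / P"
    by (simp add: t_def P_def prod_dividef)
  ultimately have "?G \<le> P"
    using P by (simp add: divide_le_eq)
  then show ?thesis
    by (simp add: lattice_count_def P_def lam_def)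
qed

end
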